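(* Let $N\ge 1$ and let $a=(a_1,\dots,a_N)\in\mathbb{R}^N$. Then the volume entropy of the Riemannian manifold $(\mathbb{R}^{N+1},g_a)$ is $$\delta(g_a)=\max\left(\sum_{i:\,a_i\ge 0}a_i,\ \sum_{i:\,a_i<0}|a_i|\right).$$
   Context: For $a\in\mathbb{R}^N$, $g_a$ is the Riemannian metric on $\mathbb{R}^{N+1}$ given by $g_a=\sum_{i=1}^{N}e^{-2a_ix_{N+1}}\,dx_i^2+dx_{N+1}^2$. The space $(\mathbb{R}^{N+1},g_a)$ is homogeneous. Its volume entropy is $\delta(g_a)=\lim_{r\to\infty}\frac{\log \operatorname{Vol}(B(x,r))}{r}$, where $B(x,r)$ is the geodesic ball of center $x$ and radius $r$ and $\operatorname{Vol}$ is the Riemannian volume; by homogeneity it does not depend on $x$. Empty sums are $0$. *)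

theory Defs
  imports "HOL-Analysis.Analysis"
begin

text \<open>
  A Riemannian metric on a Euclidean space is given by its matrix field in the standard global
  chart: \<open>G p\<close> is the Gram matrix of the coordinate fields at the point \<open>p\<close>.

  In the length, the Lebesgue integral is valued in \<^typ>\<open>ennreal\<close> on purpose: \<^const>\<open>valid_path\<close>
  admits an unbounded derivative near finitely many parameters, hence curves of infinite
  length, for which a real-valued integral would return \<open>0\<close>. The derivative is junk at these
  finitely many parameters, which form a null set.
\<close>

definition riem_norm :: "(real ^ 'm \<Rightarrow> real ^ 'm ^ 'm) \<Rightarrow> real ^ 'm \<Rightarrow> real ^ 'm \<Rightarrow> real"
  where "riem_norm G p v = sqrt (v \<bullet> (G p *v v))"

definition riem_length :: "(real ^ 'm \<Rightarrow> real ^ 'm ^ 'm) \<Rightarrow> (real \<Rightarrow> real ^ 'm) \<Rightarrow> ennreal"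
  where "riem_length G \<gamma> =
    (\<integral>\<^sup>+t\<in>{0..1}. ennreal (riem_norm G (\<gamma> t) (vector_derivative \<gamma> (at t))) \<partial>lborel)"

definition riem_dist :: "(real ^ 'm \<Rightarrow> real ^ 'm ^ 'm) \<Rightarrow> real ^ 'm \<Rightarrow> real ^ 'm \<Rightarrow> ennreal"
  where "riem_dist G p q =
    (INF \<gamma>\<in>{\<gamma>. valid_path \<gamma> \<and> pathstart \<gamma> = p \<and> pathfinish \<gamma> = q}. riem_length G \<gamma>)"

definition riem_ball :: "(real ^ 'm \<Rightarrow> real ^ 'm ^ 'm) \<Rightarrow> real ^ 'm \<Rightarrow> real \<Rightarrow> (real ^ 'm) set"
  where "riem_ball G p r = {q. riem_dist G p q < ennreal r}"

definition riem_vol :: "(real ^ 'm \<Rightarrow> real ^ 'm ^ 'm) \<Rightarrow> (real ^ 'm) set \<Rightarrow> ennreal"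
  where "riem_vol G A = (\<integral>\<^sup>+p\<in>A. ennreal (sqrt (det (G p))) \<partial>lborel)"

definition ennreal_ln :: "ennreal \<Rightarrow> ereal"
  where "ennreal_ln v =
    (if v = 0 then -\<infinity> else if v = \<infinity> then \<infinity> else ereal (ln (enn2real v)))"

text \<open>
  The limit is required to exist and to have the same value for every centre. With the extended
  logarithm, a finite limit forces balls of large radius, hence all balls, to have finite volume.
\<close>

definition has_volume_entropy :: "(real ^ 'm \<Rightarrow> real ^ 'm ^ 'm) \<Rightarrow> real \<Rightarrow> bool"
    (infix "has'_volume'_entropy" 50)
  where "G has_volume_entropy \<delta> \<longleftrightarrow>
    (\<forall>p. ((\<lambda>r. ennreal_ln (riem_vol G (riem_ball G p r)) / ereal r) \<longlongrightarrow> ereal \<delta>) at_top)"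

text \<open>
  With \<open>N = CARD('n)\<close>, the space of dimension \<open>N + 1\<close> is indexed by \<^typ>\<open>'n option\<close>:
  \<^term>\<open>p $ Some i\<close> is the coordinate \<open>x\<^sub>i\<close>, and \<^term>\<open>p $ None\<close> is the last coordinate.
\<close>

definition metric_g :: "real ^ 'n \<Rightarrow> real ^ ('n option) \<Rightarrow> real ^ ('n option) ^ ('n option)"
  where "metric_g a p =
    (\<chi> k l. if k = l
             then (case k of Some i \<Rightarrow> exp (- 2 * (a $ i) * (p $ None)) | None \<Rightarrow> 1)
             else 0)"

lemma metric_g_quadratic_form:
  fixes a :: "real ^ 'n" and p v :: "real ^ ('n option)"
  shows "v \<bullet> (metric_g a p *v v) =
    (\<Sum>i\<in>UNIV. exp (- 2 * (a $ i) * (p $ None)) * (v $ Some i)\<^sup>2) + (v $ None)\<^sup>2"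
proof -
  have "v \<bullet> (metric_g a p *v v) = (\<Sum>k\<in>UNIV.
      (case k of Some i \<Rightarrow> exp (- 2 * (a $ i) * (p $ None)) | None \<Rightarrow> 1) * (v $ k)\<^sup>2)"
    by (simp add: inner_vec_def matrix_vector_mult_def metric_g_def if_distrib
        if_distribR sum.delta power2_eq_square mult_ac cong: if_cong)
  also have "\<dots> = (\<Sum>i\<in>UNIV. exp (- 2 * (a $ i) * (p $ None)) * (v $ Some i)\<^sup>2) + (v $ None)\<^sup>2"
    by (simp add: UNIV_option_conv sum.reindex)
  finally show ?thesis .
qed

end

theory Submission
  imports Defs "HOL-Real_Asymp.Real_Asymp"
begin

text \<open>
  Write \<open>P\<close> and \<open>Q\<close> for the sums of the positive and of the negative parts of the \<open>a\<^sub>i\<close>; the volume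
  density at height \<open>s\<close> is \<open>exp ((Q - P) s)\<close>.

  Upper bound: a curve of length \<open>< r\<close> with heights in \<open>[m, M]\<close> has \<open>M - m \<le> r\<close>, and it moves \<open>x\<^sub>i\<close>
  by at most \<open>r exp (a\<^sub>i M)\<close> if \<open>a\<^sub>i \<ge> 0\<close> and by at most \<open>r exp (a\<^sub>i m)\<close> otherwise. The box of these
  points, weighted by the density at height \<open>s\<close>, contributes the exponent
  \<open>P (M - s) + Q (s - m) \<le> max P Q * (M - m)\<close>. Rounding \<open>M\<close> and \<open>m\<close> covers the ball by
  polynomially many such boxes.

  Lower bound: to realise \<open>P\<close>, move the \<open>x\<^sub>i\<close> with \<open>a\<^sub>i \<ge> 0\<close> at the starting height, descend by
  about \<open>r\<close>, and move the remaining \<open>x\<^sub>i\<close> at the final height, where distances \<open>exp (\<bar>a\<^sub>i\<bar> r)\<close> cost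
  \<open>O(1)\<close>. For \<open>Q\<close>, ascend instead.
\<close>

section \<open>Pointwise estimates for the norm and the volume density of
  \<open>metric_g\<close>\<close>

lemma riem_norm_scaleR: "riem_norm G p (c *\<^sub>R v) = \<bar>c\<bar> * riem_norm G p v"
proof -
  have "(c *\<^sub>R v) \<bullet> (G p *v (c *\<^sub>R v)) = c\<^sup>2 * (v \<bullet> (G p *v v))"
    by (simp add: matrix_vector_mult_scaleR power2_eq_square)
  then show ?thesis
    by (simp add: riem_norm_def real_sqrt_mult)
qed

text \<open>As an l2 norm of weighted components, the Riemannian norm lies below the sum of these
  components and above each single one. The next three lemmas extract these bounds: the first serves
  to estimate distances from above, the other two to estimate lengths from below.\<close>

lemma riem_norm_metric_g_eq_L2_set:
  fixes a :: "real ^ 'n"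
  shows "riem_norm (metric_g a) p v =
    L2_set (\<lambda>k. case k of Some i \<Rightarrow> exp (- (a $ i) * p $ None) * \<bar>v $ Some i\<bar> | None \<Rightarrow> \<bar>v $ None\<bar>) UNIV"
proof -
  have "(exp (- (a $ i) * p $ None) * \<bar>v $ Some i\<bar>)\<^sup>2
      = exp (- 2 * (a $ i) * (p $ None)) * (v $ Some i)\<^sup>2" for i
    by (simp add: power_mult_distrib flip: exp_double)
  then show ?thesis
    unfolding riem_norm_def metric_g_quadratic_form L2_set_def
    by (simp add: UNIV_option_conv sum.reindex add.commute)
qed

lemma riem_norm_metric_g_le:
  fixes a :: "real ^ 'n"
  shows "riem_norm (metric_g a) p v
    \<le> (\<Sum>i\<in>UNIV. exp (- (a $ i) * p $ None) * \<bar>v $ Some i\<bar>) + \<bar>v $ None\<bar>"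
proof -
  have "riem_norm (metric_g a) p v \<le>
    (\<Sum>k\<in>UNIV. case k of Some i \<Rightarrow> exp (- (a $ i) * p $ None) * \<bar>v $ Some i\<bar> | None \<Rightarrow> \<bar>v $ None\<bar>)"
    unfolding riem_norm_metric_g_eq_L2_set by (rule L2_set_le_sum) (simp split: option.split)
  then show ?thesis
    by (simp add: UNIV_option_conv sum.reindex algebra_simps)
qed

lemma horizontal_le_riem_norm_metric_g:
  fixes a :: "real ^ 'n"
  shows "exp (- (a $ i) * p $ None) * \<bar>v $ Some i\<bar> \<le> riem_norm (metric_g a) p v"
  unfolding riem_norm_metric_g_eq_L2_set
  using member_le_L2_set[of UNIV "Some i"
      "\<lambda>k. case k of Some i \<Rightarrow> exp (- (a $ i) * p $ None) * \<bar>v $ Some i\<bar> | None \<Rightarrow> \<bar>v $ None\<bar>"]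
  by simp

lemma vertical_le_riem_norm_metric_g:
  fixes a :: "real ^ 'n"
  shows "\<bar>v $ None\<bar> \<le> riem_norm (metric_g a) p v"
  unfolding riem_norm_metric_g_eq_L2_set
  using member_le_L2_set[of UNIV None
      "\<lambda>k. case k of Some i \<Rightarrow> exp (- (a $ i) * p $ None) * \<bar>v $ Some i\<bar> | None \<Rightarrow> \<bar>v $ None\<bar>"]
  by simp

lemma sqrt_det_metric_g:
  fixes a :: "real ^ 'n"
  shows "sqrt (det (metric_g a p)) = exp (- (\<Sum>i\<in>UNIV. a $ i) * p $ None)"
proof -
  have "det (metric_g a p) = (\<Prod>k\<in>UNIV. metric_g a p $ k $ k)"
    by (rule det_diagonal) (simp add: metric_g_def)
  also have "\<dots> = (\<Prod>i\<in>UNIV. exp (- 2 * (a $ i) * (p $ None)))"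
    by (simp add: UNIV_option_conv prod.reindex metric_g_def)
  also have "\<dots> = (exp (- (\<Sum>i\<in>UNIV. a $ i) * p $ None))\<^sup>2"
    by (simp add: exp_sum sum_distrib_left sum_distrib_right sum_negf mult_ac
        flip: exp_double exp_sum)
  finally show ?thesis
    by simp
qed

section \<open>Volumes of boxes, and the fundamental theorem of calculus with extended
  integrals\<close>

lemma emeasure_lborel_cbox_cart:
  fixes l u :: "real ^ 'm"
  assumes "\<And>k. l $ k \<le> u $ k"
  shows "emeasure lborel (cbox l u) = ennreal (\<Prod>k\<in>UNIV. u $ k - l $ k)"
proof -
  have "cbox l u \<noteq> {}"
    using assms by (auto simp: interval_ne_empty_cart)
  then have "measure lborel (cbox l u) = (\<Prod>k\<in>UNIV. u $ k - l $ k)"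
    by (rule content_cbox_cart)
  then show ?thesis
    using emeasure_eq_ennreal_measure[of lborel "cbox l u"] emeasure_lborel_cbox_finite[of l u]
    by (simp add: less_top)
qed

text \<open>The derivative may blow up near \<open>S\<close>, so its integrability is not automatic.
  If its absolute integral is infinite, so is the right-hand side. Otherwise the Lebesgue integral
  exists, agrees with the gauge integral given by the fundamental theorem, and the norm bound for
  integrals applies.\<close>

lemma abs_diff_le_nn_integral_derivative:
  fixes f f' :: "real \<Rightarrow> real"
  assumes "finite S" "x \<le> y" and contf: "continuous_on {x..y} f"
    and der: "\<And>t. t \<in> {x..y} - S \<Longrightarrow> (f has_vector_derivative f' t) (at t)"
    and contf': "continuous_on ({x..y} - S) f'"
    and bound: "\<And>t. t \<in> {x..y} - S \<Longrightarrow> ennreal \<bar>f' t\<bar> \<le> h t"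
  shows "ennreal \<bar>f y - f x\<bar> \<le> (\<integral>\<^sup>+t\<in>{x..y}. h t \<partial>lborel)"
proof -
  \<comment> \<open>The cut-off makes the integrand Borel measurable: \<open>f'\<close> is
    continuous on \<open>{x..y} - S\<close> and arbitrary elsewhere.\<close>
  define F where "F t = indicator ({x..y} - S) t *\<^sub>R f' t" for t
  have meas: "F \<in> borel_measurable borel"
    unfolding F_def using assms(1) contf'
    by (intro borel_measurable_continuous_on_indicator) (auto intro: borel_closed finite_imp_closed)
  have le: "(\<integral>\<^sup>+t. ennreal (norm (F t)) \<partial>lborel) \<le> (\<integral>\<^sup>+t\<in>{x..y}. h t \<partial>lborel)"
    by (rule nn_integral_mono) (auto simp: F_def indicator_def bound)
  show ?thesis
  proof (cases "(\<integral>\<^sup>+t. ennreal (norm (F t)) \<partial>lborel) < \<infinity>")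
    case True
    then have int: "integrable lborel F"
      using meas by (intro integrableI_bounded) auto
    have "(f' has_integral (f y - f x)) {x..y}"
      using assms by (intro fundamental_theorem_of_calculus_interior_strong[of S]) auto
    then have "((\<lambda>t. if t \<in> {x..y} then f' t else 0) has_integral (f y - f x)) UNIV"
      by (subst has_integral_restrict_UNIV)
    then have "(F has_integral (f y - f x)) UNIV"
      using assms(1)
      by (rule has_integral_spike_finite[rotated 2]) (auto simp: F_def indicator_def)
    then have "f y - f x = integral\<^sup>L lborel F"
      using has_integral_integral_lborel[OF int] has_integral_unique by blast
    then have "ennreal \<bar>f y - f x\<bar> \<le> (\<integral>\<^sup>+t. ennreal (norm (F t)) \<partial>lborel)"
      using integral_norm_bound_ennreal[OF int] by simp
    then show ?thesis
      using le by order
  next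
    case False
    then have "(\<integral>\<^sup>+t\<in>{x..y}. h t \<partial>lborel) = \<infinity>"
      using le by (simp flip: less_top add: top_unique)
    then show ?thesis by simp
  qed
qed

section \<open>Upper bounds for the distance, from explicit broken lines\<close>

lemma riem_dist_le_three_segments:
  fixes G :: "real ^ 'm \<Rightarrow> real ^ 'm ^ 'm"
  assumes 1: "\<And>x. x \<in> closed_segment p u \<Longrightarrow> riem_norm G x (u - p) \<le> L\<^sub>1"
    and 2: "\<And>x. x \<in> closed_segment u v \<Longrightarrow> riem_norm G x (v - u) \<le> L\<^sub>2"
    and 3: "\<And>x. x \<in> closed_segment v q \<Longrightarrow> riem_norm G x (q - v) \<le> L\<^sub>3"
    and nonneg: "0 \<le> L\<^sub>1" "0 \<le> L\<^sub>2" "0 \<le> L\<^sub>3"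
  shows "riem_dist G p q \<le> ennreal (L\<^sub>1 + L\<^sub>2 + L\<^sub>3)"
proof -
  define \<gamma> where "\<gamma> = linepath p u +++ (linepath u v +++ linepath v q)"
  \<comment> \<open>The joined path runs through its first segment during \<open>{0..1/2}\<close>
    and through the other two during \<open>{1/2..3/4}\<close> and \<open>{3/4..1}\<close>, so its
    velocity is 2, 4 and 4 times the respective displacement.\<close>
  define B where "B t = ennreal (2 * L\<^sub>1) * indicator {0..1/2} t
      + ennreal (4 * L\<^sub>2) * indicator {1/2..3/4} t + ennreal (4 * L\<^sub>3) * indicator {3/4..1} t" for t :: real
  have deriv: "riem_norm G (\<gamma> t) (vector_derivative \<gamma> (at t)) \<le> c * L"
    if seg: "\<And>s. s \<in> {l<..<r} \<Longrightarrow> \<gamma> s = linepath x y (c * s + d)"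
      and t: "t \<in> {l<..<r}" and "c * t + d \<in> {0..1}" "0 \<le> c"
      and bd: "\<And>z. z \<in> closed_segment x y \<Longrightarrow> riem_norm G z (y - x) \<le> L"
    for l r t c d L and x y :: "real ^ 'm"
  proof -
    have "((\<lambda>s. linepath x y (c * s + d)) has_vector_derivative c *\<^sub>R (y - x)) (at t)"
      unfolding linepath_def by (auto intro!: derivative_eq_intros simp: algebra_simps)
    then have "(\<gamma> has_vector_derivative c *\<^sub>R (y - x)) (at t)"
      by (rule has_vector_derivative_transform_within_open[OF _ _ t]) (auto simp: seg)
    then have "vector_derivative \<gamma> (at t) = c *\<^sub>R (y - x)"
      by (rule vector_derivative_at)
    moreover have "\<gamma> t \<in> closed_segment x y"
      using that linepath_in_path[of "c * t + d" x y] by auto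
    ultimately show ?thesis
      using bd[of "\<gamma> t"] \<open>0 \<le> c\<close> by (simp add: riem_norm_scaleR mult_left_mono)
  qed
  \<comment> \<open>The joints, where the velocity may be undefined, and the end points form a null
    set.\<close>
  have "AE t in lborel. t \<notin> {0, 1/2, 3/4, 1::real}"
    by (rule AE_not_in) (auto intro!: finite_imp_null_set_lborel)
  then have "AE t in lborel. ennreal (riem_norm G (\<gamma> t) (vector_derivative \<gamma> (at t))) * indicator {0..1} t
      \<le> B t"
  proof eventually_elim
    case (elim t)
    consider "t \<notin> {0..1}" | "t \<in> {0<..<1/2}" | "t \<in> {1/2<..<3/4}" | "t \<in> {3/4<..<1}"
      using elim by force
    then show ?case
    proof cases
      case 2
      then show ?thesis
        using deriv[of 0 "1/2" p u 2 0 t L\<^sub>1] 1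
        by (auto simp: B_def \<gamma>_def joinpaths_def intro!: ennreal_leI)
    next
      case 3
      then show ?thesis
        using deriv[of "1/2" "3/4" u v 4 "-2" t L\<^sub>2] 2
        by (auto simp: B_def \<gamma>_def joinpaths_def algebra_simps intro!: ennreal_leI)
    next
      case 4
      then show ?thesis
        using deriv[of "3/4" 1 v q 4 "-3" t L\<^sub>3] 3
        by (auto simp: B_def \<gamma>_def joinpaths_def algebra_simps intro!: ennreal_leI)
    qed (simp add: B_def)
  qed
  then have "riem_length G \<gamma> \<le> (\<integral>\<^sup>+t. B t \<partial>lborel)"
    unfolding riem_length_def by (rule nn_integral_mono_AE)
  also have "\<dots> = ennreal (L\<^sub>1 + L\<^sub>2 + L\<^sub>3)"
  proof -
    have "(\<integral>\<^sup>+t. B t \<partial>lborel) =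
        ennreal (2 * L\<^sub>1) * ennreal (1/2) + ennreal (4 * L\<^sub>2) * ennreal (1/4) + ennreal (4 * L\<^sub>3) * ennreal (1/4)"
      unfolding B_def by (simp add: nn_integral_add nn_integral_cmult_indicator)
    then show ?thesis
      using nonneg by (simp del: ennreal_half flip: ennreal_mult ennreal_plus)
  qed
  finally have "riem_length G \<gamma> \<le> ennreal (L\<^sub>1 + L\<^sub>2 + L\<^sub>3)" .
  moreover have "riem_dist G p q \<le> riem_length G \<gamma>"
    unfolding riem_dist_def by (rule INF_lower) (simp add: \<gamma>_def valid_path_join)
  ultimately show ?thesis by order
qed


text \<open>The curve moves the coordinates in \<open>S\<close> at the height of \<open>p\<close>,
  then changes height, then moves the other coordinates at the height of \<open>q\<close>. The set
  \<open>S\<close> stays free so that each coordinate can be moved where this is cheap.\<close>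

lemma riem_dist_metric_g_le:
  fixes a :: "real ^ 'n" and S :: "'n set"
  shows "riem_dist (metric_g a) p q \<le> ennreal ((\<Sum>i\<in>UNIV.
      exp (- (a $ i) * (if i \<in> S then p $ None else q $ None)) * \<bar>q $ Some i - p $ Some i\<bar>)
    + \<bar>q $ None - p $ None\<bar>)"
proof -
  define u :: "real ^ 'n option" where
    "u = (\<chi> k. case k of Some i \<Rightarrow> if i \<in> S then q $ Some i else p $ Some i | None \<Rightarrow> p $ None)"
  define v :: "real ^ 'n option" where
    "v = (\<chi> k. case k of Some i \<Rightarrow> if i \<in> S then q $ Some i else p $ Some i | None \<Rightarrow> q $ None)"
  define L\<^sub>1 where "L\<^sub>1 =
    (\<Sum>i\<in>UNIV. if i \<in> S then exp (- (a $ i) * p $ None) * \<bar>q $ Some i - p $ Some i\<bar> else 0)"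
  define L\<^sub>3 where "L\<^sub>3 =
    (\<Sum>i\<in>UNIV. if i \<in> S then 0 else exp (- (a $ i) * q $ None) * \<bar>q $ Some i - p $ Some i\<bar>)"
  have const: "x $ k = y $ k" if "x \<in> closed_segment y z" "z $ k = y $ k"
    for x y z :: "real ^ 'n option" and k
    using that by (auto simp: in_segment simp flip: distrib_right)
  have "riem_dist (metric_g a) p q \<le> ennreal (L\<^sub>1 + \<bar>q $ None - p $ None\<bar> + L\<^sub>3)"
  proof (rule riem_dist_le_three_segments)
    show "riem_norm (metric_g a) x (u - p) \<le> L\<^sub>1" if "x \<in> closed_segment p u" for x
    proof -
      have "x $ None = p $ None" using const[OF that, of None] by (simp add: u_def)
      then show ?thesis
        by (intro order_trans[OF riem_norm_metric_g_le])
          (auto simp: L\<^sub>1_def u_def intro!: sum_mono)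
    qed
    \<comment> \<open>Only the height differs between \<open>u\<close> and \<open>v\<close>, and its
      coefficient in the metric is constant, so this bound holds at every \<open>x\<close>.\<close>
    show "riem_norm (metric_g a) x (v - u) \<le> \<bar>q $ None - p $ None\<bar>" for x
      using riem_norm_metric_g_le[of a x "v - u"] by (simp add: u_def v_def)
    show "riem_norm (metric_g a) x (q - v) \<le> L\<^sub>3" if "x \<in> closed_segment v q" for x
    proof -
      have "x $ None = q $ None" using const[OF that, of None] by (simp add: v_def)
      then show ?thesis
        by (intro order_trans[OF riem_norm_metric_g_le])
          (auto simp: L\<^sub>3_def v_def intro!: sum_mono)
    qed
  qed (auto simp: L\<^sub>1_def L\<^sub>3_def intro!: sum_nonneg)
  moreover have "L\<^sub>1 + L\<^sub>3 = (\<Sum>i\<in>UNIV.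
      exp (- (a $ i) * (if i \<in> S then p $ None else q $ None)) * \<bar>q $ Some i - p $ Some i\<bar>)"
    unfolding L\<^sub>1_def L\<^sub>3_def sum.distrib[symmetric] by (rule sum.cong) auto
  ultimately show ?thesis
    by (metis add.assoc add.commute)
qed

section \<open>Displacement of a curve in terms of its length\<close>

lemma component_diff_le_riem_length:
  fixes \<gamma> :: "real \<Rightarrow> real ^ 'm"
  assumes "valid_path \<gamma>" "0 \<le> x" "x \<le> y" "y \<le> 1" "0 \<le> c"
    and bound: "\<And>t v. t \<in> {0..1} \<Longrightarrow> c * \<bar>v $ k\<bar> \<le> riem_norm G (\<gamma> t) v"
  shows "ennreal (c * \<bar>\<gamma> y $ k - \<gamma> x $ k\<bar>) \<le> riem_length G \<gamma>"
proof -
  have sub: "{x..y} \<subseteq> {0..1}"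
    using assms by auto
  obtain S D where S: "finite S" "continuous_on {0..1} \<gamma>" "continuous_on ({0..1} - S) D"
      "\<And>t. t \<in> {0..1} - S \<Longrightarrow> (\<gamma> has_vector_derivative D t) (at t)"
    using \<open>valid_path \<gamma>\<close>
    unfolding valid_path_def piecewise_C1_differentiable_on_def C1_differentiable_on_def by blast
  have "ennreal \<bar>c * \<gamma> y $ k - c * \<gamma> x $ k\<bar> \<le>
      (\<integral>\<^sup>+t\<in>{x..y}. ennreal (riem_norm G (\<gamma> t) (vector_derivative \<gamma> (at t))) \<partial>lborel)"
  proof (rule abs_diff_le_nn_integral_derivative[OF S(1) \<open>x \<le> y\<close>, where f' = "\<lambda>t. c * D t $ k"])
    show "continuous_on {x..y} (\<lambda>t. c * \<gamma> t $ k)"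
      using S(2) sub by (intro continuous_intros) (rule continuous_on_subset)
    show "continuous_on ({x..y} - S) (\<lambda>t. c * D t $ k)"
      using S(3) sub by (intro continuous_intros) (auto intro: continuous_on_subset)
    fix t assume t: "t \<in> {x..y} - S"
    then have der: "(\<gamma> has_vector_derivative D t) (at t)"
      using S(4) sub by blast
    have "((\<lambda>t. \<gamma> t $ k) has_vector_derivative D t $ k) (at t)"
      using bounded_linear.has_vector_derivative[OF bounded_linear_vec_nth der] .
    then show "((\<lambda>t. c * \<gamma> t $ k) has_vector_derivative c * D t $ k) (at t)"
      by (rule has_vector_derivative_mult_right)
    have "\<bar>c * D t $ k\<bar> \<le> riem_norm G (\<gamma> t) (D t)"
      using bound[of t "D t"] t sub \<open>0 \<le> c\<close> by (auto simp: abs_mult)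
    then show "ennreal \<bar>c * D t $ k\<bar> \<le> ennreal (riem_norm G (\<gamma> t) (vector_derivative \<gamma> (at t)))"
      using vector_derivative_at[OF der] by (simp add: ennreal_leI)
  qed
  also have "\<dots> \<le> riem_length G \<gamma>"
    unfolding riem_length_def using sub
    by (intro nn_integral_mono) (auto simp: indicator_def)
  finally show ?thesis
    using \<open>0 \<le> c\<close> by (simp add: abs_mult flip: right_diff_distrib)
qed

text \<open>Here \<open>m\<close> and \<open>M\<close> are the extreme heights along a curve of
  length less than \<open>r\<close> from \<open>p\<close> to \<open>q\<close>. The length controls
  their difference, and they control how cheap horizontal motion can become on the way.\<close>

lemma riem_ball_metric_g_height_range:
  fixes a :: "real ^ 'n"
  assumes q: "q \<in> riem_ball (metric_g a) p r"
  obtains m M where "m \<le> p $ None" "p $ None \<le> M" "m \<le> q $ None" "q $ None \<le> M" "M - m \<le> r"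
    "\<And>i. \<bar>q $ Some i - p $ Some i\<bar> \<le> r * exp (max 0 (a $ i) * M - max 0 (- (a $ i)) * m)"
proof -
  obtain \<gamma> where \<gamma>: "valid_path \<gamma>" "\<gamma> 0 = p" "\<gamma> 1 = q" "riem_length (metric_g a) \<gamma> < ennreal r"
    using q by (auto simp: riem_ball_def riem_dist_def INF_less_iff pathstart_def pathfinish_def)
  have le_r: "z \<le> r" if "ennreal z \<le> riem_length (metric_g a) \<gamma>" for z
  proof -
    have "ennreal z < ennreal r" using that \<gamma>(4) by order
    then show ?thesis by (metis ennreal_leI leI less_le_not_le nle_le)
  qed
  have cont: "continuous_on {0..1} (\<lambda>t. \<gamma> t $ None)"
    using valid_path_imp_path[OF \<gamma>(1)] unfolding path_def by (intro continuous_intros)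
  obtain x where x: "x \<in> {0..1}" "\<And>t. t \<in> {0..1} \<Longrightarrow> \<gamma> x $ None \<le> \<gamma> t $ None"
    using continuous_attains_inf[OF _ _ cont] by auto
  obtain y where y: "y \<in> {0..1}" "\<And>t. t \<in> {0..1} \<Longrightarrow> \<gamma> t $ None \<le> \<gamma> y $ None"
    using continuous_attains_sup[OF _ _ cont] by auto
  define m where "m = \<gamma> x $ None"
  define M where "M = \<gamma> y $ None"
  show ?thesis
  proof
    show "m \<le> p $ None" "p $ None \<le> M" "m \<le> q $ None" "q $ None \<le> M"
      using x(2)[of 0] y(2)[of 0] x(2)[of 1] y(2)[of 1] \<gamma> by (auto simp: m_def M_def)
    \<comment> \<open>The minimum and the maximum of the height may be attained in either order, so
      the displacement is taken from the earlier of the two times to the later.\<close>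
    have "1 * \<bar>\<gamma> (max x y) $ None - \<gamma> (min x y) $ None\<bar> \<le> r"
      using x(1) y(1) vertical_le_riem_norm_metric_g[where a = a]
      by (intro le_r component_diff_le_riem_length[OF \<gamma>(1)]) auto
    then show "M - m \<le> r"
      by (auto simp: m_def M_def max_def min_def split: if_splits)
    fix i
    \<comment> \<open>\<open>c\<close> is the maximum of \<open>a $ i * s\<close> over the heights
      \<open>s\<close> in \<open>{m..M}\<close>, so \<open>exp (- c)\<close> bounds the weight of
      the \<open>i\<close>-th component from below along the whole curve.\<close>
    define c where "c = max 0 (a $ i) * M - max 0 (- (a $ i)) * m"
    have "exp (- c) * \<bar>\<gamma> 1 $ Some i - \<gamma> 0 $ Some i\<bar> \<le> r"
    proof (intro le_r component_diff_le_riem_length[OF \<gamma>(1)])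
      fix t :: real and v :: "real ^ 'n option" assume t: "t \<in> {0..1}"
      have "a $ i * \<gamma> t $ None \<le> c"
        using x(2)[OF t] y(2)[OF t]
        by (auto simp: c_def m_def M_def max_def mult_left_mono mult_left_mono_neg)
      then have "exp (- c) * \<bar>v $ Some i\<bar> \<le> exp (- (a $ i) * \<gamma> t $ None) * \<bar>v $ Some i\<bar>"
        by (intro mult_right_mono) auto
      then show "exp (- c) * \<bar>v $ Some i\<bar> \<le> riem_norm (metric_g a) (\<gamma> t) v"
        using horizontal_le_riem_norm_metric_g[of a i "\<gamma> t" v] by linarith
    qed auto
    then show "\<bar>q $ Some i - p $ Some i\<bar> \<le> r * exp c"
      using \<gamma>(2,3) by (simp add: exp_minus field_simps)
  qed
qed


section \<open>Volume of balls, from above and from below\<close>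

lemma sum_max_diff: "(\<Sum>i\<in>UNIV. max 0 (f i)) - (\<Sum>i\<in>UNIV. max 0 (- f i)) = (\<Sum>i\<in>UNIV. f i)"
  for f :: "'n::finite \<Rightarrow> real"
  unfolding sum_subtractf[symmetric] by (rule sum.cong) auto

lemma prod_UNIV_option:
  "(\<Prod>k\<in>UNIV. f k) = f None * (\<Prod>i\<in>UNIV. f (Some i))"
  for f :: "'n::finite option \<Rightarrow> 'a::comm_monoid_mult"
  by (simp add: UNIV_option_conv prod.reindex)

text \<open>Of the cube of \<open>r + 2\<close>, two factors count the boxes and one bounds the
  height of a box. The power of \<open>2 * r\<close> comes from the horizontal widths
  \<open>2 * r * exp (c k l i)\<close>; their exponentials, combined with the density, give the last
  factor.\<close>

lemma riem_vol_ball_metric_g_le: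
  fixes a :: "real ^ 'n"
  assumes r: "0 < r"
    and P: "(\<Sum>i\<in>UNIV. max 0 (a $ i)) \<le> D" and Q: "(\<Sum>i\<in>UNIV. max 0 (- (a $ i))) \<le> D"
  shows "riem_vol (metric_g a) (riem_ball (metric_g a) p r)
    \<le> ennreal ((r + 2) ^ 3 * (2 * r) ^ CARD('n) * exp (D * (r + 2)))"
proof -
  define P where "P = (\<Sum>i\<in>UNIV. max 0 (a $ i))"
  define Q where "Q = (\<Sum>i\<in>UNIV. max 0 (- (a $ i)))"
  define t where "t = p $ None"
  \<comment> \<open>The displacement exponent of \<open>riem_ball_metric_g_height_range\<close>,
    with the extreme heights rounded away from \<open>t\<close> to \<open>t + real k\<close> and
    \<open>t - real l\<close>.\<close>
  define c where "c k l i = max 0 (a $ i) * (t + real k) - max 0 (- (a $ i)) * (t - real l)" for k l :: nat and i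
  define lo :: "nat \<Rightarrow> nat \<Rightarrow> real ^ 'n option" where
    "lo k l = (\<chi> j. case j of Some i \<Rightarrow> p $ Some i - r * exp (c k l i) | None \<Rightarrow> t - real l)" for k l
  define hi :: "nat \<Rightarrow> nat \<Rightarrow> real ^ 'n option" where
    "hi k l = (\<chi> j. case j of Some i \<Rightarrow> p $ Some i + r * exp (c k l i) | None \<Rightarrow> t + real k)" for k l
  \<comment> \<open>Chosen so that its product with the exponentials of the box widths is exactly
    \<open>exp (D * (r + 2))\<close>. That it bounds the density on the box is shown below.\<close>
  define dens where "dens k l = exp (D * (r + 2) - (\<Sum>i\<in>UNIV. c k l i))" for k l
  define n where "n = nat \<lceil>r\<rceil>"
  \<comment> \<open>The height range is at most \<open>r\<close>, and each of the two roundings adds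
    less than 1.\<close>
  define I where "I = {(k, l) \<in> {..n} \<times> {..n}. real k + real l \<le> r + 2}"
  have D: "0 \<le> D"
    using P by (intro order_trans[OF _ P] sum_nonneg) auto
  have PQ: "0 \<le> P" "P \<le> D" "0 \<le> Q" "Q \<le> D" "P - Q = (\<Sum>i\<in>UNIV. a $ i)"
    using assms sum_max_diff[of "($) a"] by (auto simp: P_def Q_def intro: sum_nonneg)
  have sum_c: "(\<Sum>i\<in>UNIV. c k l i) = P * (t + real k) - Q * (t - real l)" for k l
    by (simp add: c_def P_def Q_def sum_subtractf sum_distrib_right)
  have "finite I"
    by (rule finite_subset[of _ "{..n} \<times> {..n}"]) (auto simp: I_def)
  have cover: "\<exists>(k, l)\<in>I. q \<in> cbox (lo k l) (hi k l)" if q: "q \<in> riem_ball (metric_g a) p r" for q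
  proof -
    obtain m M where mM: "m \<le> t" "t \<le> M" "m \<le> q $ None" "q $ None \<le> M" "M - m \<le> r"
      and disp: "\<And>i. \<bar>q $ Some i - p $ Some i\<bar> \<le> r * exp (max 0 (a $ i) * M - max 0 (- (a $ i)) * m)"
      using riem_ball_metric_g_height_range[OF q] unfolding t_def by blast
    define k where "k = nat \<lceil>M - t\<rceil>"
    define l where "l = nat \<lceil>t - m\<rceil>"
    have k: "M - t \<le> real k" "real k < M - t + 1" and l: "t - m \<le> real l" "real l < t - m + 1"
      using mM unfolding k_def l_def by linarith+
    have "k \<le> n" "l \<le> n"
      unfolding k_def l_def n_def using mM by (intro nat_mono ceiling_mono; linarith)+
    then have "(k, l) \<in> I"
      using k l mM by (auto simp: I_def)
    moreover have "\<bar>q $ Some i - p $ Some i\<bar> \<le> r * exp (c k l i)" for i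
    proof -
      have "max 0 (a $ i) * M \<le> max 0 (a $ i) * (t + real k)"
        using k by (intro mult_left_mono) auto
      moreover have "max 0 (- (a $ i)) * (t - real l) \<le> max 0 (- (a $ i)) * m"
        using l by (intro mult_left_mono) auto
      ultimately have "r * exp (max 0 (a $ i) * M - max 0 (- (a $ i)) * m) \<le> r * exp (c k l i)"
        using r unfolding c_def by simp
      then show ?thesis using disp[of i] by linarith
    qed
    then have "q \<in> cbox (lo k l) (hi k l)"
      using mM k l by (auto simp: mem_box_cart lo_def hi_def abs_le_iff algebra_simps split: option.split)
    ultimately show ?thesis by auto
  qed
  have dens: "exp (- (\<Sum>i\<in>UNIV. a $ i) * q $ None) \<le> dens k l"
    if "(k, l) \<in> I" "q \<in> cbox (lo k l) (hi k l)" for k l q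
  proof -
    define s where "s = q $ None"
    have "lo k l $ None \<le> s" "s \<le> hi k l $ None"
      using that(2) by (auto simp: mem_box_cart s_def)
    then have s: "0 \<le> t + real k - s" "0 \<le> s - (t - real l)"
      by (simp_all add: lo_def hi_def)
    \<comment> \<open>The height \<open>s\<close> splits the box height into two nonnegative parts
      with coefficients \<open>P\<close> and \<open>Q\<close>. Raising both coefficients to
      \<open>D\<close> makes \<open>s\<close> cancel.\<close>
    have "(\<Sum>i\<in>UNIV. c k l i) - (\<Sum>i\<in>UNIV. a $ i) * s = P * (t + real k - s) + Q * (s - (t - real l))"
      unfolding sum_c PQ(5)[symmetric] by (simp add: algebra_simps)
    also have "\<dots> \<le> D * (t + real k - s) + D * (s - (t - real l))"
      using PQ s by (intro add_mono mult_right_mono) auto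
    also have "\<dots> = D * (real k + real l)"
      by (simp add: algebra_simps)
    also have "\<dots> \<le> D * (r + 2)"
      using that(1) D by (intro mult_left_mono) (auto simp: I_def)
    finally show ?thesis
      by (simp add: dens_def s_def)
  qed
  have vol: "ennreal (dens k l) * emeasure lborel (cbox (lo k l) (hi k l))
      \<le> ennreal ((r + 2) * (2 * r) ^ CARD('n) * exp (D * (r + 2)))" if "(k, l) \<in> I" for k l
  proof -
    have "emeasure lborel (cbox (lo k l) (hi k l))
        = ennreal ((real k + real l) * (\<Prod>i\<in>UNIV. 2 * r * exp (c k l i)))"
      using r by (subst emeasure_lborel_cbox_cart)
        (auto simp: prod_UNIV_option lo_def hi_def mult_ac split: option.split)
    also have "(\<Prod>i\<in>UNIV. 2 * r * exp (c k l i)) = (2 * r) ^ CARD('n) * exp (\<Sum>i\<in>UNIV. c k l i)"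
      by (simp add: prod.distrib exp_sum power_mult_distrib)
    finally have "ennreal (dens k l) * emeasure lborel (cbox (lo k l) (hi k l)) =
        ennreal (dens k l * ((real k + real l) * ((2 * r) ^ CARD('n) * exp (\<Sum>i\<in>UNIV. c k l i))))"
      using r by (simp add: dens_def ennreal_mult)
    also have "dens k l * ((real k + real l) * ((2 * r) ^ CARD('n) * exp (\<Sum>i\<in>UNIV. c k l i)))
        = (real k + real l) * (2 * r) ^ CARD('n) * exp (D * (r + 2))"
      by (simp add: dens_def exp_diff)
    also have "\<dots> \<le> (r + 2) * (2 * r) ^ CARD('n) * exp (D * (r + 2))"
      using that r by (intro mult_right_mono) (auto simp: I_def)
    finally show ?thesis by (simp add: ennreal_leI)
  qed
  have "riem_vol (metric_g a) (riem_ball (metric_g a) p r)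
      \<le> (\<integral>\<^sup>+q. (\<Sum>(k, l)\<in>I. ennreal (dens k l) * indicator (cbox (lo k l) (hi k l)) q) \<partial>lborel)"
    unfolding riem_vol_def sqrt_det_metric_g
  proof (rule nn_integral_mono)
    fix q
    show "ennreal (exp (- (\<Sum>i\<in>UNIV. a $ i) * q $ None)) * indicator (riem_ball (metric_g a) p r) q
      \<le> (\<Sum>(k, l)\<in>I. ennreal (dens k l) * indicator (cbox (lo k l) (hi k l)) q)"
    proof (cases "q \<in> riem_ball (metric_g a) p r")
      case True
      then obtain k l where kl: "(k, l) \<in> I" "q \<in> cbox (lo k l) (hi k l)"
        using cover by blast
      then have "ennreal (exp (- (\<Sum>i\<in>UNIV. a $ i) * q $ None))
          \<le> (case (k, l) of (k, l) \<Rightarrow> ennreal (dens k l) * indicator (cbox (lo k l) (hi k l)) q)"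
        using dens[OF kl] by (simp add: ennreal_leI)
      also have "\<dots> \<le> (\<Sum>(k, l)\<in>I. ennreal (dens k l) * indicator (cbox (lo k l) (hi k l)) q)"
        using \<open>finite I\<close> kl(1) by (intro member_le_sum) auto
      finally show ?thesis using True by simp
    qed simp
  qed
  also have "\<dots> = (\<Sum>(k, l)\<in>I. ennreal (dens k l) * emeasure lborel (cbox (lo k l) (hi k l)))"
    unfolding case_prod_beta
    by (subst nn_integral_sum) (auto simp: nn_integral_cmult_indicator)
  also have "\<dots> \<le> (\<Sum>_\<in>I. ennreal ((r + 2) * (2 * r) ^ CARD('n) * exp (D * (r + 2))))"
    using vol by (intro sum_mono) auto
  also have "\<dots> = ennreal (real (card I) * ((r + 2) * (2 * r) ^ CARD('n) * exp (D * (r + 2))))"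
    using r by (simp add: ennreal_mult ennreal_of_nat_eq_real_of_nat)
  also have "\<dots> \<le> ennreal ((r + 2)\<^sup>2 * ((r + 2) * (2 * r) ^ CARD('n) * exp (D * (r + 2))))"
  proof (intro ennreal_leI mult_right_mono)
    have "card I \<le> card ({..n} \<times> {..n})"
      by (rule card_mono) (auto simp: I_def)
    then have "real (card I) \<le> real ((n + 1)\<^sup>2)"
      unfolding of_nat_le_iff by (simp add: card_cartesian_product power2_eq_square)
    also have "\<dots> \<le> (r + 2)\<^sup>2"
    proof -
      have "real n + 1 \<le> r + 2" using r unfolding n_def by linarith
      then show ?thesis by (simp add: power_mono)
    qed
    finally show "real (card I) \<le> (r + 2)\<^sup>2" .
  qed (use r in auto)
  also have "(r + 2)\<^sup>2 * ((r + 2) * (2 * r) ^ CARD('n) * exp (D * (r + 2))) =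
      (r + 2) ^ 3 * (2 * r) ^ CARD('n) * exp (D * (r + 2))"
    by (simp add: power2_eq_square power3_eq_cube mult_ac)
  finally show ?thesis .
qed

text \<open>The curves in this lemma descend if \<open>\<sigma> = 1\<close> and ascend if \<open>\<sigma> = -1\<close>.\<close>

lemma riem_vol_ball_metric_g_ge:
  fixes a :: "real ^ 'n"
  assumes r: "3 \<le> r" and \<sigma>: "\<bar>\<sigma>\<bar> = 1"
  shows "ennreal ((2 / CARD('n)) ^ CARD('n) *
      exp ((r - 3) * (\<Sum>i\<in>UNIV. max 0 (\<sigma> * a $ i)) - \<bar>\<Sum>i\<in>UNIV. a $ i\<bar>))
    \<le> riem_vol (metric_g a) (riem_ball (metric_g a) p r)"
proof -
  define N where "N = real CARD('n)"
  define A where "A = (\<Sum>i\<in>UNIV. a $ i)"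
  define D where "D = (\<Sum>i\<in>UNIV. max 0 (\<sigma> * a $ i))"
  define t where "t = p $ None"
  \<comment> \<open>A lower bound for \<open>a $ i * h\<close>, where \<open>h\<close> is the height
    at which coordinate \<open>i\<close> is moved: \<open>t\<close> if
    \<open>\<sigma> * a $ i\<close> is nonnegative, and otherwise the final height
    \<open>t - \<sigma> * (r - \<rho>)\<close> with \<open>\<rho>\<close> in \<open>{2..3}\<close>,
    the worst case being \<open>\<rho> = 3\<close>.\<close>
  define c where "c i = a $ i * t + max 0 (- (\<sigma> * a $ i)) * (r - 3)" for i
  \<comment> \<open>The heights in the box are those with \<open>\<rho>\<close> in
    \<open>{2..3}\<close>, an interval of length 1 written around its centre to suit both signs of
    \<open>\<sigma>\<close>. The vertical leg costs at most \<open>r - 2\<close>, and division by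
    \<open>N\<close> keeps the total horizontal cost at most 1, so the length stays below
    \<open>r\<close>.\<close>
  define lo :: "real ^ 'n option" where
    "lo = (\<chi> j. case j of Some i \<Rightarrow> p $ Some i - exp (c i) / N | None \<Rightarrow> t - \<sigma> * (r - 5/2) - 1/2)"
  define hi :: "real ^ 'n option" where
    "hi = (\<chi> j. case j of Some i \<Rightarrow> p $ Some i + exp (c i) / N | None \<Rightarrow> t - \<sigma> * (r - 5/2) + 1/2)"
  have N: "0 < N"
    by (simp add: N_def)
  have \<sigma>': "\<sigma> = 1 \<or> \<sigma> = - 1"
    using \<sigma> by linarith
  have height: "\<exists>\<rho>\<in>{2..3}. q $ None = t - \<sigma> * (r - \<rho>)" if "q \<in> cbox lo hi" for q
  proof
    have "lo $ None \<le> q $ None" "q $ None \<le> hi $ None"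
      using that by (auto simp: mem_box_cart)
    then show "r - \<sigma> * (t - q $ None) \<in> {2..3}"
      using \<sigma>' by (auto simp: lo_def hi_def)
    show "q $ None = t - \<sigma> * (r - (r - \<sigma> * (t - q $ None)))"
      using \<sigma>' by auto
  qed
  have "cbox lo hi \<subseteq> riem_ball (metric_g a) p r"
  proof
    fix q assume q: "q \<in> cbox lo hi"
    then obtain \<rho> where \<rho>: "2 \<le> \<rho>" "\<rho> \<le> 3" and s: "q $ None = t - \<sigma> * (r - \<rho>)"
      using height by fastforce
    \<comment> \<open>These coordinates are moved at the starting height; the weights of all others
      shrink on the way to the final height.\<close>
    define S where "S = {i. 0 \<le> \<sigma> * a $ i}"
    have "exp (- (a $ i) * (if i \<in> S then p $ None else q $ None)) * \<bar>q $ Some i - p $ Some i\<bar> \<le> 1 / N" for i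
    proof -
      have "lo $ Some i \<le> q $ Some i" "q $ Some i \<le> hi $ Some i"
        using q by (auto simp: mem_box_cart)
      then have "\<bar>q $ Some i - p $ Some i\<bar> \<le> exp (c i) / N"
        by (simp add: lo_def hi_def abs_le_iff)
      moreover have "exp (- (a $ i) * (if i \<in> S then p $ None else q $ None)) \<le> exp (- c i)"
      proof (cases "i \<in> S")
        case True
        then show ?thesis by (simp add: S_def c_def t_def)
      next
        case False
        then have neg: "\<sigma> * a $ i < 0" by (simp add: S_def)
        then have "\<sigma> * a $ i * (r - \<rho>) \<le> \<sigma> * a $ i * (r - 3)"
          using \<rho> by (intro mult_left_mono_neg) auto
        then show ?thesis
          using False neg by (simp add: c_def s algebra_simps)
      qed
      ultimately have "exp (- (a $ i) * (if i \<in> S then p $ None else q $ None)) * \<bar>q $ Some i - p $ Some i\<bar>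
          \<le> exp (- c i) * (exp (c i) / N)"
        by (intro mult_mono) auto
      then show ?thesis by (simp add: exp_minus)
    qed
    then have "(\<Sum>i\<in>UNIV. exp (- (a $ i) * (if i \<in> S then p $ None else q $ None)) * \<bar>q $ Some i - p $ Some i\<bar>)
        \<le> (\<Sum>i\<in>(UNIV :: 'n set). 1 / N)"
      by (intro sum_mono) auto
    also have "\<dots> = 1"
      using N by (simp add: N_def)
    finally have "(\<Sum>i\<in>UNIV. exp (- (a $ i) * (if i \<in> S then p $ None else q $ None)) * \<bar>q $ Some i - p $ Some i\<bar>)
        + \<bar>q $ None - p $ None\<bar> < r"
      using s \<rho> r \<sigma>' by (auto simp: t_def)
    then have "riem_dist (metric_g a) p q < ennreal r"
      using r by (intro le_less_trans[OF riem_dist_metric_g_le[of a p q S]] ennreal_lessI) auto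
    then show "q \<in> riem_ball (metric_g a) p r"
      by (simp add: riem_ball_def)
  qed
  \<comment> \<open>The density at \<open>\<rho> = 3\<close>, lowered by the factor
    \<open>exp (- \<bar>A\<bar>)\<close> to allow for \<open>\<rho>\<close> varying over an interval
    of length 1.\<close>
  define d where "d = exp (- A * t + \<sigma> * A * (r - 3) - \<bar>A\<bar>)"
  have dens: "d \<le> exp (- A * q $ None)" if q: "q \<in> cbox lo hi" for q
  proof -
    obtain \<rho> where \<rho>: "2 \<le> \<rho>" "\<rho> \<le> 3" and s: "q $ None = t - \<sigma> * (r - \<rho>)"
      using height[OF q] by fastforce
    have "\<bar>\<sigma> * A * (\<rho> - 3)\<bar> \<le> \<bar>A\<bar> * 1"
      unfolding abs_mult \<sigma> mult_1 using \<rho> by (intro mult_left_mono) auto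
    then show ?thesis
      by (simp add: d_def s algebra_simps)
  qed
  have sum_c: "(\<Sum>i\<in>UNIV. c i) = A * t + (D - \<sigma> * A) * (r - 3)"
  proof -
    have "(\<Sum>i\<in>UNIV. max 0 (- (\<sigma> * a $ i))) = D - \<sigma> * A"
      using sum_max_diff[of "\<lambda>i. \<sigma> * a $ i"] by (simp add: D_def A_def sum_distrib_left)
    then show ?thesis
      by (simp add: c_def sum.distrib A_def flip: sum_distrib_right)
  qed
  have "ennreal ((2 / N) ^ CARD('n) * exp ((r - 3) * D - \<bar>A\<bar>))
      = ennreal (d * (\<Prod>i\<in>(UNIV :: 'n set). 2 / N * exp (c i)))"
  proof -
    have "d * (\<Prod>i\<in>(UNIV :: 'n set). 2 / N * exp (c i)) = (2 / N) ^ CARD('n) * (d * exp (\<Sum>i\<in>UNIV. c i))"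
      by (simp add: prod.distrib prod_dividef exp_sum power_divide)
    \<comment> \<open>The terms \<open>A * t\<close> and \<open>\<sigma> * A * (r - 3)\<close> of
      the density cancel against those in \<open>sum_c\<close>; in particular the dependence on the
      centre disappears.\<close>
    also have "d * exp (\<Sum>i\<in>UNIV. c i) = exp ((r - 3) * D - \<bar>A\<bar>)"
      unfolding d_def exp_add[symmetric] sum_c by (simp add: algebra_simps)
    finally show ?thesis by simp
  qed
  also have "\<dots> = ennreal d * emeasure lborel (cbox lo hi)"
  proof -
    have "emeasure lborel (cbox lo hi) = ennreal (\<Prod>i\<in>(UNIV :: 'n set). 2 / N * exp (c i))"
      using N by (subst emeasure_lborel_cbox_cart)
        (auto simp: prod_UNIV_option lo_def hi_def split: option.split)
    then show ?thesis
      using N by (simp add: ennreal_mult d_def prod_nonneg)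
  qed
  also have "\<dots> = (\<integral>\<^sup>+q. ennreal d * indicator (cbox lo hi) q \<partial>lborel)"
    by (simp add: nn_integral_cmult_indicator)
  also have "\<dots> \<le> riem_vol (metric_g a) (riem_ball (metric_g a) p r)"
    unfolding riem_vol_def sqrt_det_metric_g
    using \<open>cbox lo hi \<subseteq> _\<close> dens
    by (intro nn_integral_mono) (auto simp: indicator_def A_def intro!: ennreal_leI)
  finally show ?thesis
    by (simp add: N_def A_def D_def)
qed

section \<open>Logarithms of the volume bounds and the limit\<close>

lemma ennreal_ln_mono: "x \<le> y \<Longrightarrow> ennreal_ln x \<le> ennreal_ln y"
  by (cases x; cases y) (auto simp: ennreal_ln_def top_unique)

lemma ennreal_ln_ennreal: "0 < x \<Longrightarrow> ennreal_ln (ennreal x) = ereal (ln x)"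
  by (simp add: ennreal_ln_def)

theorem theorem1:
  fixes a :: "real ^ 'n"
  shows "metric_g a has_volume_entropy
    max (\<Sum>i | a $ i \<ge> 0. a $ i) (\<Sum>i | a $ i < 0. \<bar>a $ i\<bar>)"
proof -
  define D where "D \<sigma> = (\<Sum>i\<in>UNIV. max 0 (\<sigma> * a $ i))" for \<sigma>
  define \<delta> where "\<delta> = max (\<Sum>i | a $ i \<ge> 0. a $ i) (\<Sum>i | a $ i < 0. \<bar>a $ i\<bar>)"
  have "(\<Sum>i | a $ i \<ge> 0. a $ i) = (\<Sum>i\<in>UNIV. if a $ i \<ge> 0 then a $ i else 0)"
    by (simp add: sum.If_cases)
  also have "\<dots> = D 1"
    unfolding D_def by (rule sum.cong) auto
  finally have "\<delta> = max (D 1) (\<Sum>i | a $ i < 0. \<bar>a $ i\<bar>)"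
    by (simp add: \<delta>_def)
  also have "(\<Sum>i | a $ i < 0. \<bar>a $ i\<bar>) = (\<Sum>i\<in>UNIV. if a $ i < 0 then \<bar>a $ i\<bar> else 0)"
    by (simp add: sum.If_cases)
  also have "\<dots> = D (- 1)"
    unfolding D_def by (rule sum.cong) auto
  finally have \<delta>: "\<delta> = max (D 1) (D (- 1))" .
  \<comment> \<open>The sign \<open>\<sigma>\<close> selects the larger of the two sums, so the
    lower volume bound is applied in one direction only, while the upper bound uses the maximum
    itself.\<close>
  then obtain \<sigma> :: real where \<sigma>: "\<bar>\<sigma>\<bar> = 1" "\<delta> = D \<sigma>"
    by (metis abs_1 abs_minus_cancel max_def)
  define N where "N = CARD('n)"
  define A where "A = \<bar>\<Sum>i\<in>UNIV. a $ i\<bar>"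
  have "((\<lambda>r. ennreal_ln (riem_vol (metric_g a) (riem_ball (metric_g a) p r)) / ereal r) \<longlongrightarrow> ereal \<delta>) at_top" for p
  proof (rule tendsto_sandwich)
    define V where "V r = riem_vol (metric_g a) (riem_ball (metric_g a) p r)" for r
    \<comment> \<open>\<open>f\<close> and \<open>g\<close> are the logarithms of the lower and
      upper volume bounds, divided by \<open>r\<close>. In both numerators everything except
      \<open>\<delta> * r\<close> grows at most logarithmically.\<close>
    define f where "f r = (real N * ln (2 / real N) + ((r - 3) * \<delta> - A)) / r" for r
    define g where "g r = (3 * ln (r + 2) + real N * ln (2 * r) + \<delta> * (r + 2)) / r" for r
    have N: "0 < real N"
      by (simp add: N_def)
    have div_mono: "x / ereal r \<le> y / ereal r" if "x \<le> y" "0 < r" for x y r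
      using that by (intro ereal_divide_right_mono) auto
    show "\<forall>\<^sub>F r in at_top. ereal (f r) \<le> ennreal_ln (V r) / ereal r"
      using eventually_ge_at_top[of 3]
    proof eventually_elim
      case (elim r)
      have "ereal (real N * ln (2 / real N) + ((r - 3) * \<delta> - A))
          = ennreal_ln (ennreal ((2 / real N) ^ N * exp ((r - 3) * \<delta> - A)))"
        using N by (subst ennreal_ln_ennreal) (simp_all add: ln_mult ln_realpow)
      also have "\<dots> \<le> ennreal_ln (V r)"
        using riem_vol_ball_metric_g_ge[OF elim \<sigma>(1), of a p]
        by (intro ennreal_ln_mono) (simp add: V_def N_def A_def \<sigma>(2) D_def)
      finally show ?case
        using div_mono[of _ _ r] elim unfolding f_def by fastforce
    qed
    show "\<forall>\<^sub>F r in at_top. ennreal_ln (V r) / ereal r \<le> ereal (g r)"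
      using eventually_gt_at_top[of 0]
    proof eventually_elim
      case (elim r)
      have "ennreal_ln (V r) \<le> ennreal_ln (ennreal ((r + 2) ^ 3 * (2 * r) ^ N * exp (\<delta> * (r + 2))))"
        using riem_vol_ball_metric_g_le[OF elim, of a \<delta> p] \<delta>
        by (intro ennreal_ln_mono) (simp add: V_def N_def D_def)
      also have "\<dots> = ereal (3 * ln (r + 2) + real N * ln (2 * r) + \<delta> * (r + 2))"
        using elim by (subst ennreal_ln_ennreal) (simp_all add: ln_mult_pos ln_realpow distrib_left)
      finally show ?case
        using div_mono[of _ _ r] elim unfolding g_def by fastforce
    qed
    have "(f \<longlongrightarrow> \<delta>) at_top"
      unfolding f_def by real_asymp
    then show "((\<lambda>r. ereal (f r)) \<longlongrightarrow> ereal \<delta>) at_top"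
      by simp
    have "(g \<longlongrightarrow> \<delta>) at_top"
      unfolding g_def by real_asymp
    then show "((\<lambda>r. ereal (g r)) \<longlongrightarrow> ereal \<delta>) at_top"
      by simp
  qed
  then show ?thesis
    unfolding has_volume_entropy_def \<delta>_def by blast
qed

end
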